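(* (i) For a positive integer $k$, let $b=2k+1$, $N=\frac{b^4-1}{2}$ and $\mathbf{v}=(1,b,b^2,b^3)$. Then $$\lim_{k\to\infty}\frac{\lambda^{\ast}(\Pi^4_{N,\mathbf{v}})}{N^{3/4}}=2^{1/4}.$$ (ii) For a positive integer $k$, let $b=2k+1$, $N=\frac{b^5-1}{2}$ and $\mathbf{v}=(1,b,b^2,b^3,b^4)$. Then $$\lim_{k\to\infty}\frac{\lambda^{\ast}(\Pi^5_{N,\mathbf{v}})}{N^{4/5}}=2^{3/10}.$$ In both parts $N$ and $\mathbf{v}$ depend on $k$ as indicated.
   Context: For $d\in\{4,5\}$ and integers $N,a_1,\dots,a_d$ with $0<a_1<\dots<a_d<N$ and $\gcd(N,a_1)=1$, write $\mathbf{v}=(a_1,\dots,a_d)$ and define $$\Pi^d_{N,\mathbf{v}}=\{(na_1 \bmod N,\ \dots,\ na_d \bmod N): 0\le n<N\}\subset[0,N-1]^d,$$ where $x \bmod N$ denotes the least nonnegative residue of $x$ modulo $N$, and $$\lambda^{\ast}(\Pi^d_{N,\mathbf{v}})=\min_{\mathbf{x}\neq\mathbf{y},\ \mathbf{x},\mathbf{y}\in\Pi^d_{N,\mathbf{v}}}\|\mathbf{x}-\mathbf{y}\|$$ (Euclidean norm). *)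

theory Defs
  imports "HOL-Analysis.Analysis"
begin

text \<open>
  The dimension \<open>d\<close> is the cardinality of the index type. The generating vector is natural-valued
  and the points are embedded in \<open>real ^ 'd\<close>, so that \<^const>\<open>dist\<close> is the Euclidean distance.
\<close>

definition point_set :: "nat \<Rightarrow> nat ^ 'd \<Rightarrow> (real ^ 'd) set" where
  "point_set N v = (\<lambda>n. \<chi> i. real ((n * v $ i) mod N)) ` {0..<N}"

definition lambda_star :: "(real ^ 'd) set \<Rightarrow> real" where
  "lambda_star P = Min {dist x y | x y. x \<in> P \<and> y \<in> P \<and> x \<noteq> y}"

text \<open>
  \<^const>\<open>Min\<close> is unspecified on empty and infinite sets. For the sets used here it is a true
  minimum: \<open>point_set N v\<close> is finite, and it has \<open>N\<close> elements whenever some entry of \<open>v\<close> is \<open>1\<close>.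
\<close>

lemma finite_point_set: "finite (point_set N v)"
  by (simp add: point_set_def)

lemma card_point_set:
  fixes v :: "nat ^ 'd"
  assumes "v $ i = 1"
  shows "card (point_set N v) = N"
proof -
  have "inj_on (\<lambda>n. (\<chi> i. real ((n * v $ i) mod N)) :: real ^ 'd) {0..<N}"
  proof (rule inj_onI)
    fix m n
    assume mn: "m \<in> {0..<N}" "n \<in> {0..<N}"
      and eq: "((\<chi> i. real ((m * v $ i) mod N)) :: real ^ 'd) = (\<chi> i. real ((n * v $ i) mod N))"
    from arg_cong[OF eq, of "\<lambda>x. x $ i"] show "m = n"
      using mn assms by simp
  qed
  then show ?thesis
    by (simp add: point_set_def card_image)
qed

text \<open>
  Coordinates of \<^const>\<open>vector\<close> in dimensions 4 and 5 (the last index, \<open>4 :: 4\<close> or \<open>5 :: 5\<close>, is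
  the numeral \<open>0\<close> of that type).
\<close>

lemma vector_4_nth:
  "(vector [x, y, z, w] :: 'a::zero ^ 4) $ 1 = x"
  "(vector [x, y, z, w] :: 'a ^ 4) $ 2 = y"
  "(vector [x, y, z, w] :: 'a ^ 4) $ 3 = z"
  "(vector [x, y, z, w] :: 'a ^ 4) $ 4 = w"
  by (simp_all add: vector_def)

lemma vector_5_nth:
  "(vector [x, y, z, w, u] :: 'a::zero ^ 5) $ 1 = x"
  "(vector [x, y, z, w, u] :: 'a ^ 5) $ 2 = y"
  "(vector [x, y, z, w, u] :: 'a ^ 5) $ 3 = z"
  "(vector [x, y, z, w, u] :: 'a ^ 5) $ 4 = w"
  "(vector [x, y, z, w, u] :: 'a ^ 5) $ 5 = u"
  by (simp_all add: vector_def)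

text \<open>For odd \<open>b\<close> the integer division by 2 in \<open>(b ^ d - 1) div 2\<close> is exact.\<close>

lemma two_times_half_odd_power:
  assumes "odd (b :: nat)"
  shows "2 * ((b ^ d - 1) div 2) = b ^ d - 1"
  using assms by simp

end

theory Submission
  imports Defs "HOL-Real_Asymp.Real_Asymp"
begin

text \<open>
  Write \<open>b ^ d = 2 * N + 1\<close>. If \<open>u\<close> is the difference of two distinct points, then
  \<open>b * u\<^sub>j - u\<^sub>j\<^sub>+\<^sub>1 = N * c\<^sub>j\<close> with integers \<open>c\<^sub>j\<close> (indices modulo \<open>d\<close>), since \<open>b ^ d\<close> is
  \<open>1\<close> modulo \<open>N\<close>. The vector \<open>c\<close> is nonzero, and as \<open>b ^ d\<close> is \<open>1\<close> even modulo \<open>2 * N\<close>, the sum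
  of its entries is even: it lies in the root lattice \<open>D\<^sub>d\<close>, whose minimal squared norm is 2. Hence
  \<open>(b + 1) * norm u \<ge> sqrt 2 * N\<close>. The point with \<open>n = (b + 1) div 2\<close>, whose
  difference from \<open>0\<close> corresponds to a minimal vector of \<open>D\<^sub>d\<close>, attains this bound asymptotically.
\<close>

section \<open>Integer vectors of even sum and the lower bound for residue differences\<close>

lemma even_sum_power2:
  fixes c :: "'a \<Rightarrow> int"
  shows "even (\<Sum>x\<in>A. (c x)\<^sup>2) \<longleftrightarrow> even (\<Sum>x\<in>A. c x)"
proof -
  have "even (\<Sum>x\<in>A. (c x)\<^sup>2 - c x)"
    by (intro dvd_sum) simp
  then show ?thesis
    by (simp add: sum_subtractf)
qed

text \<open>The sum of squares is positive and has the parity of the sum of entries, so it cannot be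
  1.\<close>

lemma two_le_sum_power2:
  fixes c :: "'a \<Rightarrow> int"
  assumes "finite A" "even (\<Sum>x\<in>A. c x)" "x \<in> A" "c x \<noteq> 0"
  shows "2 \<le> (\<Sum>x\<in>A. (c x)\<^sup>2)"
proof -
  have "0 < (\<Sum>x\<in>A. (c x)\<^sup>2)"
    using assms by (intro sum_pos2[of _ x]) auto
  moreover have "even (\<Sum>x\<in>A. (c x)\<^sup>2)"
    using assms(2) by (simp add: even_sum_power2)
  ultimately show ?thesis
    by (auto elim!: evenE)
qed

text \<open>\<open>b\<close> times the identity minus the cyclic shift has operator norm at most
  \<open>b + 1\<close>. Weighted Cauchy-Schwarz with weights \<open>b\<close> and 1, applied
  termwise, proves this without square roots, so that it can be used over the integers.\<close>

lemma sum_power2_cyclic_le: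
  fixes u :: "nat \<Rightarrow> 'a::linordered_idom"
  assumes "u d = u 0" "0 \<le> b"
  shows "(\<Sum>j<d. (b * u j - u (Suc j))\<^sup>2) \<le> (b + 1)\<^sup>2 * (\<Sum>j<d. (u j)\<^sup>2)"
proof -
  have shift: "(\<Sum>j<d. (u (Suc j))\<^sup>2) = (\<Sum>j<d. (u j)\<^sup>2)"
    using sum.lessThan_Suc_shift[of "\<lambda>j. (u j)\<^sup>2" d] assms(1) by simp
  have "(b * x - y)\<^sup>2 \<le> (b + 1) * (b * x\<^sup>2 + y\<^sup>2)" for x y
  proof -
    have "(b + 1) * (b * x\<^sup>2 + y\<^sup>2) - (b * x - y)\<^sup>2 = b * (x + y)\<^sup>2"
      by (simp add: power2_eq_square algebra_simps)
    then show ?thesis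
      using assms(2) by (metis diff_ge_0_iff_ge mult_nonneg_nonneg zero_le_power2)
  qed
  then have "(\<Sum>j<d. (b * u j - u (Suc j))\<^sup>2) \<le> (\<Sum>j<d. (b + 1) * (b * (u j)\<^sup>2 + (u (Suc j))\<^sup>2))"
    by (intro sum_mono)
  also have "\<dots> = (b + 1) * (b * (\<Sum>j<d. (u j)\<^sup>2) + (\<Sum>j<d. (u (Suc j))\<^sup>2))"
    by (simp add: sum.distrib flip: sum_distrib_left)
  also have "\<dots> = (b + 1)\<^sup>2 * (\<Sum>j<d. (u j)\<^sup>2)"
    unfolding shift by (simp add: power2_eq_square algebra_simps)
  finally show ?thesis .
qed

lemma residue_difference_bound:
  fixes b d N m n :: nat
  assumes bd: "b ^ d = 2 * N + 1" and "odd b" "n < N" "m < N" "n \<noteq> m"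
  shows "2 * (int N)\<^sup>2 \<le>
    (int b + 1)\<^sup>2 * (\<Sum>j<d. (int (n * b ^ j mod N) - int (m * b ^ j mod N))\<^sup>2)"
proof -
  define u where "u j = int (n * b ^ j mod N) - int (m * b ^ j mod N)" for j
  define k where "k j = int (n * b ^ j div N) - int (m * b ^ j div N)" for j
  define c where "c j = k (Suc j) - int b * k j" for j
  have u: "u j = (int n - int m) * int b ^ j - int N * k j" for j
    by (simp add: u_def k_def zmod_int zdiv_int algebra_simps minus_mult_div_eq_mod[symmetric])
  have Nc: "int b * u j - u (Suc j) = int N * c j" for j
    by (simp add: u c_def algebra_simps)
  \<comment> \<open>The residue \<open>l\<close> closes the cycle, \<open>u d = u 0\<close>; the
    even quotient \<open>2 * l\<close> is what yields the parity of the sum of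
    \<open>c\<close>.\<close>
  have multiple: "l * b ^ d = l + N * (2 * l)" for l
    by (simp add: bd algebra_simps)
  have mult_mod: "l * b ^ d mod N = l" and mult_div: "l * b ^ d div N = 2 * l" if "l < N" for l
    using that by (simp_all add: multiple)
  have ud: "u d = u 0"
    using mult_mod \<open>n < N\<close> \<open>m < N\<close> by (simp add: u_def)
  \<comment> \<open>As \<open>b\<close> is odd, \<open>c j\<close> agrees modulo 2 with
    \<open>k (Suc j) - k j\<close>, and the sum of the latter telescopes.\<close>
  have "even ((k (Suc j) - k j) - c j)" for j
    using \<open>odd b\<close> by (simp add: c_def)
  then have "even (\<Sum>j<d. k (Suc j) - k j - c j)"
    by (intro dvd_sum) auto
  moreover have "(\<Sum>j<d. k (Suc j) - k j) = 2 * (int n - int m)"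
    unfolding sum_lessThan_telescope using mult_div \<open>n < N\<close> \<open>m < N\<close> by (simp add: k_def)
  ultimately have even: "even (\<Sum>j<d. c j)"
    unfolding sum_subtractf[of _ c] by simp
  \<comment> \<open>Otherwise \<open>u\<close> is geometric with ratio \<open>b\<close>, and going
    once around the cycle forces \<open>u 0 = n - m\<close> to vanish.\<close>
  have "\<exists>j<d. c j \<noteq> 0"
  proof (rule ccontr)
    assume "\<not> ?thesis"
    then have "u (Suc j) = int b * u j" if "j < d" for j
      using Nc[of j] that by simp
    then have "j \<le> d \<Longrightarrow> u j = int b ^ j * u 0" for j
      by (induction j) auto
    from this[of d] have "u 0 = int (b ^ d) * u 0"
      unfolding ud by simp
    then have "int N * u 0 = 0"
      unfolding bd by (simp add: algebra_simps)
    then show False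
      using \<open>n < N\<close> \<open>m < N\<close> \<open>n \<noteq> m\<close> by (simp add: u_def)
  qed
  then have "2 \<le> (\<Sum>j<d. (c j)\<^sup>2)"
    using even two_le_sum_power2[of "{..<d}" c] by blast
  from mult_left_mono[OF this, of "(int N)\<^sup>2"]
  have "2 * (int N)\<^sup>2 \<le> (int N)\<^sup>2 * (\<Sum>j<d. (c j)\<^sup>2)"
    by (simp add: mult.commute)
  also have "\<dots> = (\<Sum>j<d. (int b * u j - u (Suc j))\<^sup>2)"
    by (simp add: Nc power_mult_distrib sum_distrib_left)
  also have "\<dots> \<le> (int b + 1)\<^sup>2 * (\<Sum>j<d. (u j)\<^sup>2)"
    using ud by (intro sum_power2_cyclic_le) simp_all
  finally show ?thesis
    by (simp add: u_def)
qed

section \<open>Two-sided bounds for the minimal distance\<close>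

lemma finite_distances:
  assumes "finite P"
  shows "finite {dist x y |x y. x \<in> P \<and> y \<in> P \<and> x \<noteq> y}"
  by (rule finite_subset[of _ "(\<lambda>(x, y). dist x y) ` (P \<times> P)"]) (use assms in auto)

lemma lambda_star_le_dist:
  assumes "finite P" "x \<in> P" "y \<in> P" "x \<noteq> y"
  shows "lambda_star P \<le> dist x y"
  unfolding lambda_star_def using assms by (intro Min_le finite_distances) auto

text \<open>Two distinct points are required so that \<open>Min\<close> is taken over a nonempty
  set.\<close>

lemma le_lambda_starI:
  assumes "finite P" "x \<in> P" "y \<in> P" "x \<noteq> y"
    and "\<And>x y. x \<in> P \<Longrightarrow> y \<in> P \<Longrightarrow> x \<noteq> y \<Longrightarrow> r \<le> dist x y"
  shows "r \<le> lambda_star P"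
  unfolding lambda_star_def using assms by (intro Min.boundedI finite_distances) auto

text \<open>Enumerating the index type by natural numbers makes the cyclic estimates
  applicable.\<close>

lemma dist_eq_sqrt_sum_reindex:
  fixes x y :: "real ^ 'd"
  assumes "bij_betw e {..<d} UNIV"
  shows "dist x y = sqrt (\<Sum>j<d. (x $ e j - y $ e j)\<^sup>2)"
  by (simp add: dist_vec_def L2_set_def dist_real_def
      sum.reindex_bij_betw[OF assms, of "\<lambda>i. (x $ i - y $ i)\<^sup>2"])

lemma real_le_half_power_plus_1:
  assumes "r \<le> (b ^ m + 1) div 2"
  shows "real r \<le> (real b ^ m + 1) / 2"
proof -
  have "2 * r \<le> b ^ m + 1"
    using assms by linarith
  then have "real (2 * r) \<le> real (b ^ m + 1)"
    unfolding of_nat_le_iff .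
  then show ?thesis
    by simp
qed

text \<open>The upper bound is a bound for the distance between the points with
  \<open>n = k + 1\<close> and \<open>n = 0\<close>. Both bounds are asymptotic to
  \<open>b ^ m / sqrt 2\<close>: in the upper one, the last two coordinates are each about
  \<open>b ^ m / 2\<close> and the others are of lower order.\<close>

lemma lambda_star_powers_bounds:
  fixes v :: "nat ^ 'd" and e :: "nat \<Rightarrow> 'd" and k m :: nat
  defines "b \<equiv> 2 * k + 1" and "N \<equiv> ((2 * k + 1) ^ Suc m - 1) div 2"
  assumes "0 < k" "0 < m" and bij: "bij_betw e {..<Suc m} UNIV"
    and v: "\<And>j. j < Suc m \<Longrightarrow> v $ e j = b ^ j"
  shows "sqrt 2 * real N / (real b + 1) \<le> lambda_star (point_set N v)" (is ?lower)
    and "lambda_star (point_set N v) \<le>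
      sqrt ((\<Sum>j<m. (real ((k + 1) * b ^ j))\<^sup>2) + ((real b ^ m + 1) / 2)\<^sup>2)" (is ?upper)
proof -
  define p :: "nat \<Rightarrow> real ^ 'd" where "p n = (\<chi> i. real ((n * v $ i) mod N))" for n
  have P: "point_set N v = p ` {0..<N}"
    by (simp add: point_set_def p_def)
  have "odd b"
    by (simp add: b_def)
  then have bd: "b ^ Suc m = 2 * N + 1"
    using two_times_half_odd_power[of b "Suc m"] by (simp add: N_def b_def)
  \<comment> \<open>This ensures that \<open>k + 1\<close> is an admissible value of
    \<open>n\<close>.\<close>
  have "b\<^sup>2 \<le> b ^ Suc m"
    using assms by (intro power_increasing) auto
  moreover have "2 * (k + 1) + 1 < b\<^sup>2"
    using \<open>0 < k\<close> by (cases k) (simp_all add: b_def power2_eq_square)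
  ultimately have "2 * (k + 1) + 1 < 2 * N + 1"
    unfolding bd by (rule less_le_trans[rotated])
  then have kN: "k + 1 < N"
    by simp
  have e0: "v $ e 0 = 1"
    using v[of 0] by simp
  have p0: "p n $ e 0 = real n" if "n < N" for n
    using that by (simp add: p_def e0)
  have dist: "dist (p n) (p n') =
      sqrt (\<Sum>j<Suc m. (real (n * b ^ j mod N) - real (n' * b ^ j mod N))\<^sup>2)" for n n'
    unfolding dist_eq_sqrt_sum_reindex[OF bij] p_def
    by (intro arg_cong[of _ _ sqrt] sum.cong) (simp_all add: v)
  have in_P: "p (k + 1) \<in> point_set N v" "p 0 \<in> point_set N v"
    using kN by (auto simp: P)
  have neq: "p (k + 1) \<noteq> p 0"
    using p0[of 0] p0[of "k + 1"] kN by force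
  show ?lower
  proof (rule le_lambda_starI[OF finite_point_set in_P neq])
    fix x y
    assume "x \<in> point_set N v" "y \<in> point_set N v" "x \<noteq> y"
    then obtain n n' where n: "n < N" "n' < N" "n \<noteq> n'" "x = p n" "y = p n'"
      unfolding P by (metis atLeastLessThan_iff imageE)
    define S where "S = (\<Sum>j<Suc m. (int (n * b ^ j mod N) - int (n' * b ^ j mod N))\<^sup>2)"
    have S: "dist x y = sqrt (real_of_int S)"
      unfolding n dist S_def by simp
    have "real_of_int (2 * (int N)\<^sup>2) \<le> real_of_int ((int b + 1)\<^sup>2 * S)"
      unfolding of_int_le_iff S_def
      using bd \<open>odd b\<close> n by (intro residue_difference_bound) auto
    then have "sqrt (2 * (real N)\<^sup>2) \<le> sqrt ((real b + 1)\<^sup>2 * real_of_int S)"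
      by (intro real_sqrt_le_mono) simp
    then have "sqrt 2 * real N \<le> (real b + 1) * dist x y"
      by (simp add: real_sqrt_mult S)
    then show "sqrt 2 * real N / (real b + 1) \<le> dist x y"
      by (simp add: field_simps)
  qed
  \<comment> \<open>Since \<open>2 * (k + 1) = b + 1\<close>, subtracting \<open>N\<close> once from
    the last coordinate leaves \<open>(b ^ m + 1) div 2\<close>. The other coordinates are bounded
    by their unreduced values.\<close>
  have "2 * ((k + 1) * b ^ m) = b ^ Suc m + b ^ m"
    by (simp add: b_def algebra_simps)
  then have "2 * ((k + 1) * b ^ m) = 2 * N + (b ^ m + 1)"
    using bd by simp
  then have "(k + 1) * b ^ m = (b ^ m + 1) div 2 + N"
    by linarith
  then have "(k + 1) * b ^ m mod N \<le> (b ^ m + 1) div 2"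
    by (simp only: mod_add_self2 mod_less_eq_dividend)
  then have last: "real ((k + 1) * b ^ m mod N) \<le> (real b ^ m + 1) / 2"
    by (rule real_le_half_power_plus_1)
  have "lambda_star (point_set N v) \<le> dist (p (k + 1)) (p 0)"
    by (rule lambda_star_le_dist[OF finite_point_set in_P neq])
  also have "\<dots> = sqrt ((\<Sum>j<m. (real ((k + 1) * b ^ j mod N))\<^sup>2) + (real ((k + 1) * b ^ m mod N))\<^sup>2)"
    by (simp only: dist sum.lessThan_Suc mult_0 mod_0 of_nat_0 diff_zero)
  also have "\<dots> \<le> sqrt ((\<Sum>j<m. (real ((k + 1) * b ^ j))\<^sup>2) + ((real b ^ m + 1) / 2)\<^sup>2)"
    by (intro real_sqrt_le_mono add_mono sum_mono power_mono
        last of_nat_mono mod_less_eq_dividend of_nat_0_le_iff)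
  finally show ?upper .
qed

section \<open>The limits in dimensions 4 and 5\<close>

lemma real_half_odd_power:
  "real (((2 * k + 1) ^ d - 1) div 2) = ((2 * real k + 1) ^ d - 1) / 2"
proof -
  have "real (2 * (((2 * k + 1) ^ d - 1) div 2)) = real ((2 * k + 1) ^ d - 1)"
    by (subst two_times_half_odd_power) simp_all
  also have "\<dots> = (2 * real k + 1) ^ d - 1"
    by (subst of_nat_diff) (simp_all add: add.commute)
  finally show ?thesis
    unfolding of_nat_mult by simp
qed

lemma bij_betw_UNIV_if_card_eq:
  fixes f :: "'a \<Rightarrow> 'b::finite"
  assumes "inj_on f A" "card A = CARD('b)"
  shows "bij_betw f A UNIV"
  using assms by (simp add: bij_betw_def card_eq_UNIV_imp_eq_UNIV card_image)

text \<open>Entries of \<open>vector\<close> are numbered from 1, hence the shift by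
  \<open>Suc\<close>; the last index is 0 in the type \<open>4\<close>.\<close>

lemma bij_betw_index_4: "bij_betw (\<lambda>j. of_nat (Suc j) :: 4) {..<4} UNIV"
  by (rule bij_betw_UNIV_if_card_eq) (auto simp: inj_on_def eval_nat_numeral less_Suc_eq)

lemma bij_betw_index_5: "bij_betw (\<lambda>j. of_nat (Suc j) :: 5) {..<5} UNIV"
  by (rule bij_betw_UNIV_if_card_eq) (auto simp: inj_on_def eval_nat_numeral less_Suc_eq)

text \<open>Merges the leading coefficients in the limits below into one power of 2.\<close>

lemma powr_base_2_collect:
  "2 ^ i * (2 ^ h) powr p * inverse ((2 ^ j) powr q) =
    (2 :: real) powr (real i + real h * p - real j * q)"
  by (simp add: powr_realpow[symmetric] powr_powr powr_diff powr_add divide_inverse)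

lemma lambda_star_4_limit:
  "(\<lambda>k. lambda_star (point_set (((2 * k + 1) ^ 4 - 1) div 2)
       (vector [1, 2 * k + 1, (2 * k + 1) ^ 2, (2 * k + 1) ^ 3] :: nat ^ 4))
     / real (((2 * k + 1) ^ 4 - 1) div 2) powr (3 / 4)) \<longlonglongrightarrow> 2 powr (1 / 4)"
  (is "(\<lambda>k. ?l k / ?D k) \<longlonglongrightarrow> _")
proof (rule real_tendsto_sandwich)
  let ?b = "\<lambda>k. 2 * real k + 1"
  let ?L = "\<lambda>k. sqrt 2 * real (((2 * k + 1) ^ 4 - 1) div 2) / (?b k + 1)"
  let ?U = "\<lambda>k. sqrt ((\<Sum>j<3. (real ((k + 1) * (2 * k + 1) ^ j))\<^sup>2) + ((?b k ^ 3 + 1) / 2)\<^sup>2)"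
  \<comment> \<open>For \<open>k = 0\<close> the point set is empty, so the bounds are only claimed
    eventually.\<close>
  have "?L k \<le> ?l k \<and> ?l k \<le> ?U k" if "0 < k" for k
  proof -
    have v: "(vector [1, 2 * k + 1, (2 * k + 1) ^ 2, (2 * k + 1) ^ 3] :: nat ^ 4)
        $ of_nat (Suc j) = (2 * k + 1) ^ j" if "j < Suc 3" for j
      using that by (auto simp: less_Suc_eq eval_nat_numeral vector_4_nth)
    have bij: "bij_betw (\<lambda>j. of_nat (Suc j) :: 4) {..<Suc 3} UNIV"
      using bij_betw_index_4 by simp
    show ?thesis
      using lambda_star_powers_bounds[OF that _ bij v]
      by (simp add: add.commute)
  qed
  then show "\<forall>\<^sub>F k in sequentially. ?L k / ?D k \<le> ?l k / ?D k"
    and "\<forall>\<^sub>F k in sequentially. ?l k / ?D k \<le> ?U k / ?D k"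
    by (blast intro: eventually_mono[OF eventually_gt_at_top[of 0]] divide_right_mono powr_ge_zero)+
  \<comment> \<open>As \<open>N\<close> is asymptotic to \<open>8 * k ^ 4\<close>, the leading
    coefficients are \<open>4 * sqrt 2\<close> and \<open>8 powr (3 / 4)\<close>.\<close>
  show "(\<lambda>k. ?L k / ?D k) \<longlonglongrightarrow> 2 powr (1 / 4)"
    unfolding real_half_odd_power
    by real_asymp
      (use powr_base_2_collect[of 2 1 "1 / 2" 3 "3 / 4"] in \<open>simp add: powr_half_sqrt sqrt_def\<close>)
  \<comment> \<open>The last two coordinates contribute \<open>16 * k ^ 6\<close> each under the
    root, hence the power \<open>2 ^ 5\<close>.\<close>
  show "(\<lambda>k. ?U k / ?D k) \<longlonglongrightarrow> 2 powr (1 / 4)"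
    unfolding real_half_odd_power
    by (simp add: eval_nat_numeral, real_asymp)
      (use powr_base_2_collect[of 0 5 "1 / 2" 3 "3 / 4"] in simp)
qed

lemma lambda_star_5_limit:
  "(\<lambda>k. lambda_star (point_set (((2 * k + 1) ^ 5 - 1) div 2)
       (vector [1, 2 * k + 1, (2 * k + 1) ^ 2, (2 * k + 1) ^ 3, (2 * k + 1) ^ 4] :: nat ^ 5))
     / real (((2 * k + 1) ^ 5 - 1) div 2) powr (4 / 5)) \<longlonglongrightarrow> 2 powr (3 / 10)"
  (is "(\<lambda>k. ?l k / ?D k) \<longlonglongrightarrow> _")
proof (rule real_tendsto_sandwich)
  let ?b = "\<lambda>k. 2 * real k + 1"
  let ?L = "\<lambda>k. sqrt 2 * real (((2 * k + 1) ^ 5 - 1) div 2) / (?b k + 1)"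
  let ?U = "\<lambda>k. sqrt ((\<Sum>j<4. (real ((k + 1) * (2 * k + 1) ^ j))\<^sup>2) + ((?b k ^ 4 + 1) / 2)\<^sup>2)"
  have "?L k \<le> ?l k \<and> ?l k \<le> ?U k" if "0 < k" for k
  proof -
    have v: "(vector [1, 2 * k + 1, (2 * k + 1) ^ 2, (2 * k + 1) ^ 3, (2 * k + 1) ^ 4] :: nat ^ 5)
        $ of_nat (Suc j) = (2 * k + 1) ^ j" if "j < Suc 4" for j
      using that by (auto simp: less_Suc_eq eval_nat_numeral vector_5_nth)
    have bij: "bij_betw (\<lambda>j. of_nat (Suc j) :: 5) {..<Suc 4} UNIV"
      using bij_betw_index_5 by simp
    show ?thesis
      using lambda_star_powers_bounds[OF that _ bij v]
      by (simp add: add.commute)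
  qed
  then show "\<forall>\<^sub>F k in sequentially. ?L k / ?D k \<le> ?l k / ?D k"
    and "\<forall>\<^sub>F k in sequentially. ?l k / ?D k \<le> ?U k / ?D k"
    by (blast intro: eventually_mono[OF eventually_gt_at_top[of 0]] divide_right_mono powr_ge_zero)+
  \<comment> \<open>Here \<open>N\<close> is asymptotic to \<open>16 * k ^ 5\<close>, with
    coefficients \<open>8 * sqrt 2\<close> and \<open>16 powr (4 / 5)\<close>.\<close>
  show "(\<lambda>k. ?L k / ?D k) \<longlonglongrightarrow> 2 powr (3 / 10)"
    unfolding real_half_odd_power
    by real_asymp
      (use powr_base_2_collect[of 3 1 "1 / 2" 4 "4 / 5"] in \<open>simp add: powr_half_sqrt sqrt_def\<close>)
  \<comment> \<open>Two contributions of \<open>64 * k ^ 8\<close> under the root give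
    \<open>2 ^ 7\<close>.\<close>
  show "(\<lambda>k. ?U k / ?D k) \<longlonglongrightarrow> 2 powr (3 / 10)"
    unfolding real_half_odd_power
    by (simp add: eval_nat_numeral, real_asymp)
      (use powr_base_2_collect[of 0 7 "1 / 2" 4 "4 / 5"] in simp)
qed

theorem theorem4:
  shows "((\<lambda>k::nat.
            let b = 2 * k + 1; N = (b ^ 4 - 1) div 2; v = (vector [1, b, b ^ 2, b ^ 3] :: nat ^ 4)
            in lambda_star (point_set N v) / real N powr (3 / 4))
          \<longlonglongrightarrow> 2 powr (1 / 4)) \<and>
         ((\<lambda>k::nat.
            let b = 2 * k + 1; N = (b ^ 5 - 1) div 2; v = (vector [1, b, b ^ 2, b ^ 3, b ^ 4] :: nat ^ 5)
            in lambda_star (point_set N v) / real N powr (4 / 5))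
          \<longlonglongrightarrow> 2 powr (3 / 10))"
  using lambda_star_4_limit lambda_star_5_limit unfolding Let_def by blast

end
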